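(* No oriented forest is avoidable. That is, if $F$ is an orientation of a forest, then there is no function $d_F:\mathbb{N}\to\mathbb{N}$ such that for every $k\in\mathbb{N}$, every digraph of minimum out-degree at least $d_F(k)$ contains an $F$-free subdigraph of minimum out-degree at least $k$.
   Context: Digraphs are finite, with non-empty vertex set $V(D)$ and arc set $A(D)\subseteq\{(u,v)\in V(D)^2 : u\ne v\}$ (no loops, no parallel arcs; a pair of opposite arcs is allowed). An oriented forest is a digraph obtained from a (finite undirected) forest by choosing exactly one direction for each edge. A digraph is $F$-free if it has no subdigraph (not necessarily induced) isomorphic to $F$. Subdigraphs are not required to be spanning or induced. A digraph $F$ is called avoidable if there exists $d_F:\mathbb{N}\to\mathbb{N}$ such that for every $k$, every digraph of minimum out-degree at least $d_F(k)$ contains an $F$-free subdigraph of minimum out-degree at least $k$. *)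

theory Defs
  imports "Graph_Theory.Graph_Theory"
begin

text \<open>
  A digraph is a finite loopless pair digraph, so that its arcs are ordered pairs of distinct
  vertices. The library admits the null graph, which is excluded here, also for subdigraphs.
\<close>

definition nonnull_digraph :: "'a pair_pre_digraph \<Rightarrow> bool" where
  "nonnull_digraph D \<longleftrightarrow> pair_digraph D \<and> pverts D \<noteq> {}"

definition subdigraph :: "'a pair_pre_digraph \<Rightarrow> 'a pair_pre_digraph \<Rightarrow> bool" where
  "subdigraph H D \<longleftrightarrow> nonnull_digraph H \<and> subgraph (with_proj H) (with_proj D)"

definition min_out_degree :: "'a pair_pre_digraph \<Rightarrow> nat" where
  "min_out_degree D = Min (out_degree (with_proj D) ` pverts D)"

definition free_of :: "'a pair_pre_digraph \<Rightarrow> 'b pair_pre_digraph \<Rightarrow> bool" where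
  "free_of F D \<longleftrightarrow> \<not> (\<exists>S. subdigraph S D \<and> digraph_iso (with_proj F) (with_proj S))"

text \<open>
  The host digraphs have natural numbers as vertices. This is no restriction, since every finite
  digraph is isomorphic to such a digraph and all the notions involved are invariant under
  isomorphism.
\<close>

definition avoidable :: "'a pair_pre_digraph \<Rightarrow> bool" where
  "avoidable F \<longleftrightarrow> (\<exists>d :: nat \<Rightarrow> nat. \<forall>k. \<forall>D :: nat pair_pre_digraph.
     nonnull_digraph D \<and> min_out_degree D \<ge> d k \<longrightarrow>
       (\<exists>H. subdigraph H D \<and> free_of F H \<and> min_out_degree H \<ge> k))"

text \<open>
  The library predicate \<open>forest\<close> forbids only directed cycles, and represents undirected graphs as
  symmetric digraphs, in which each edge already is a cycle of length two. Hence undirected forests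
  are described separately, by a vertex set and a set of two-element edges.
\<close>

definition undirected_graph :: "'a set \<Rightarrow> 'a set set \<Rightarrow> bool" where
  "undirected_graph V E \<longleftrightarrow> finite V \<and> (\<forall>e\<in>E. e \<subseteq> V \<and> card e = 2)"

definition undirected_cycle :: "'a set set \<Rightarrow> 'a list \<Rightarrow> bool" where
  "undirected_cycle E c \<longleftrightarrow> length c \<ge> 3 \<and> distinct c \<and>
     (\<forall>i < length c. {c ! i, c ! (Suc i mod length c)} \<in> E)"

definition undirected_forest :: "'a set \<Rightarrow> 'a set set \<Rightarrow> bool" where
  "undirected_forest V E \<longleftrightarrow> undirected_graph V E \<and> \<not> (\<exists>c. undirected_cycle E c)"

definition orientation_of :: "'a pair_pre_digraph \<Rightarrow> 'a set \<Rightarrow> 'a set set \<Rightarrow> bool" where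
  "orientation_of D V E \<longleftrightarrow> pverts D = V \<and>
     (\<forall>(u, v) \<in> parcs D. {u, v} \<in> E) \<and>
     (\<forall>u v. {u, v} \<in> E \<longrightarrow> ((u, v) \<in> parcs D) \<noteq> ((v, u) \<in> parcs D))"

definition oriented_forest :: "'a pair_pre_digraph \<Rightarrow> bool" where
  "oriented_forest F \<longleftrightarrow> nonnull_digraph F \<and>
     (\<exists>V E. undirected_forest V E \<and> orientation_of F V E)"

end

(*
  Fix k, a multiple of |F| plus a constant, and let the prescribed out-degree d be arbitrary. The host
  digraph is a tower of levels L 0, ..., L M, where L (i + 1) is hugely larger than L i. Every vertex of
  L (i + 1) sends d arcs to a random set in L i, and L 0 is joined completely to L M. With positive
  probability every small nonempty W in L i receives 7 or more arcs from fewer than |W| vertices.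

  A subdigraph H of minimum out-degree k meets every level. Going down the tower, its trace on the
  levels strictly grows as long as it is small, so if M is large, the trace on some L m is not small.
  Below L m the levels shrink so fast that most arcs of H must go to vertices of large in-degree in H.
  Deleting vertices of small in-degree or out-degree from 2|F| + 1 consecutive levels of H therefore
  leaves a nonempty part, in which all in-degrees and out-degrees towards the adjacent levels are at
  least |F|. A forest embeds there greedily, whatever its orientation.
*)
theory Submission
  imports Defs "HOL-Library.Nat_Bijection" "HOL-Library.FuncSet"
begin

section \<open>Random neighbourhoods and the union bound\<close>

text \<open>Every function counted here has \<open>K\<close> indices at which it hits
  \<open>W\<close>. There are at most \<open>2 ^ d\<close> index sets, and at each chosen index only
  \<open>t\<close> of the \<open>t^2\<close> values remain, which saves a factor \<open>t\<close>.
  In terms of probability, a uniformly random function hits \<open>W\<close> at least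
  \<open>K\<close> times with probability at most \<open>2 ^ d / t ^ K\<close>.\<close>

lemma card_functions_hitting:
  fixes W :: "(nat \<times> nat) set"
  assumes "finite W" and "card W \<le> t" and "t \<ge> 1"
  shows "card {g \<in> {..<d} \<rightarrow>\<^sub>E {..<t^2}. K \<le> card {i. i < d \<and> (i, g i) \<in> W}} * t ^ K
      \<le> 2 ^ d * (t^2) ^ d"
proof -
  let ?B = "{g \<in> {..<d} \<rightarrow>\<^sub>E {..<t^2}. K \<le> card {i. i < d \<and> (i, g i) \<in> W}}"
  let ?I = "{I. I \<subseteq> {..<d} \<and> card I = K}"
  let ?S = "\<lambda>i. {x \<in> {..<t^2}. (i, x) \<in> W}"
  let ?P = "\<lambda>I. Pi\<^sub>E {..<d} (\<lambda>i. if i \<in> I then ?S i else {..<t^2})"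
  have fin: "finite ?I" by simp
  have cI: "card ?I \<le> 2 ^ d"
    using card_mono[of "Pow {..<d}" ?I] by (auto simp: card_Pow)
  have S: "card (?S i) \<le> t" for i
  proof -
    have "card (?S i) = card (Pair i ` ?S i)" by (simp add: card_image inj_on_def)
    also have "\<dots> \<le> card W" by (rule card_mono) (use assms in auto)
    finally show ?thesis using assms by simp
  qed
  have sub: "?B \<subseteq> (\<Union>I\<in>?I. ?P I)"
  proof
    fix g assume g: "g \<in> ?B"
    then obtain I where I: "I \<subseteq> {i. i < d \<and> (i, g i) \<in> W}" "card I = K"
      using obtain_subset_with_card_n[of K "{i. i < d \<and> (i, g i) \<in> W}"] by auto
    have "g \<in> ?P I" using g I(1) by (auto simp: PiE_iff)
    moreover have "I \<in> ?I" using I by auto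
    ultimately show "g \<in> (\<Union>I\<in>?I. ?P I)" by blast
  qed
  have P: "card (?P I) * t ^ K \<le> (t^2) ^ d" if "I \<in> ?I" for I
  proof -
    have I: "I \<subseteq> {..<d}" "card I = K" using that by auto
    have "card (?P I) = (\<Prod>i<d. card (if i \<in> I then ?S i else {..<t^2}))"
      by (simp add: card_PiE)
    also have "\<dots> \<le> (\<Prod>i<d. if i \<in> I then t else t^2)"
      by (rule prod_mono) (use S in auto)
    also have "\<dots> = t ^ K * (t^2) ^ (d - K)"
    proof -
      have "{..<d} \<inter> I = I" "card ({..<d} \<inter> - I) = d - K"
        using I by (auto simp: Diff_eq[symmetric] card_Diff_subset finite_subset)
      then show ?thesis using I by (simp add: prod.If_cases)
    qed
    finally have "card (?P I) * t ^ K \<le> t ^ K * (t^2) ^ (d - K) * t ^ K" by simp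
    also have "\<dots> = (t^2) ^ (d - K) * (t^2) ^ K"
      by (simp add: power2_eq_square power_mult_distrib)
    also have "\<dots> = (t^2) ^ d"
    proof -
      have "K \<le> d" using I card_mono[of "{..<d}" I] by simp
      then show ?thesis by (simp flip: power_add)
    qed
    finally show ?thesis .
  qed
  have "card ?B \<le> card (\<Union>I\<in>?I. ?P I)"
    by (rule card_mono[OF _ sub]) (auto intro!: finite_PiE)
  also have "\<dots> \<le> (\<Sum>I\<in>?I. card (?P I))" by (rule card_UN_le[OF fin])
  finally have "card ?B * t ^ K \<le> (\<Sum>I\<in>?I. card (?P I) * t ^ K)"
    by (simp flip: sum_distrib_right)
  also have "\<dots> \<le> (\<Sum>I\<in>?I. (t^2) ^ d)" by (rule sum_mono) (rule P)
  also have "\<dots> \<le> 2 ^ d * (t^2) ^ d" using cI by simp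
  finally show ?thesis .
qed

text \<open>
  Union bound over all \<open>W\<close> and all \<open>T \<subseteq> A\<close> with \<open>card T = card W\<close> whose members hit \<open>W\<close> at least \<open>K\<close> times.
  The neighbours of \<open>x\<close> are the pairs \<open>(i, f x i)\<close>, which makes them automatically distinct.
\<close>
lemma exists_sparse_neighbourhoods_aux:
  fixes A :: "'a set"
  assumes A: "finite A" and t: "t \<ge> 1" and d: "d \<ge> 1"
    and size: "2 * card A * (d * t^2) * 2 ^ d \<le> t ^ K"
  shows "\<exists>f \<in> A \<rightarrow>\<^sub>E ({..<d} \<rightarrow>\<^sub>E {..<t^2}). \<forall>W. W \<subseteq> {..<d} \<times> {..<t^2} \<and> W \<noteq> {} \<and> card W \<le> t \<longrightarrow>
      card {x \<in> A. K \<le> card {i. i < d \<and> (i, f x i) \<in> W}} < card W"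
proof (rule ccontr)
  assume neg: "\<not> ?thesis"
  let ?G = "{..<d} \<rightarrow>\<^sub>E {..<t^2}"
  let ?F = "A \<rightarrow>\<^sub>E ?G"
  let ?V = "{..<d} \<times> {..<t^2}"
  let ?B = "\<lambda>W. {g \<in> ?G. K \<le> card {i. i < d \<and> (i, g i) \<in> W}}"
  let ?J = "\<lambda>w. {W. W \<subseteq> ?V \<and> card W = w} \<times> {T. T \<subseteq> A \<and> card T = w}"
  let ?P = "\<lambda>(W, T). Pi\<^sub>E A (\<lambda>x. if x \<in> T then ?B W else ?G)"
  have finG: "finite ?G" by (auto intro!: finite_PiE)
  have cG: "card ?G = (t^2) ^ d" by (simp add: card_PiE)
  have cF: "card ?F = ((t^2) ^ d) ^ card A" using A by (simp add: card_PiE)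
  have sub: "?F \<subseteq> (\<Union>w\<in>{1..t}. \<Union>J\<in>?J w. ?P J)"
  proof
    fix f assume f: "f \<in> ?F"
    have "\<not> (\<forall>W. W \<subseteq> ?V \<and> W \<noteq> {} \<and> card W \<le> t \<longrightarrow>
      card {x \<in> A. K \<le> card {i. i < d \<and> (i, f x i) \<in> W}} < card W)"
      by (rule notI, rule notE[OF neg], rule bexI[OF _ f])
    then obtain W where W: "W \<subseteq> ?V" "W \<noteq> {}" "card W \<le> t"
      "card W \<le> card {x \<in> A. K \<le> card {i. i < d \<and> (i, f x i) \<in> W}}"
      by (auto simp: not_less)
    obtain T where T: "T \<subseteq> {x \<in> A. K \<le> card {i. i < d \<and> (i, f x i) \<in> W}}" "card T = card W"
      by (rule obtain_subset_with_card_n[OF W(4)]) (rule that)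
    have "finite W" using W(1) by (rule finite_subset) simp
    then have "card W \<in> {1..t}" using W by (simp add: Suc_le_eq card_gt_0_iff)
    moreover have "(W, T) \<in> ?J (card W)" using W T by auto
    moreover have "f \<in> ?P (W, T)" using f T by (auto simp: PiE_iff)
    ultimately show "f \<in> (\<Union>w\<in>{1..t}. \<Union>J\<in>?J w. ?P J)" by blast
  qed
  \<comment> \<open>This bounds the probability that a single vertex hits a fixed small
    \<open>W\<close> at least \<open>K\<close> times. Choices at distinct vertices are independent,
    so \<open>w\<close> given vertices all do so with probability at most
    \<open>?r ^ w\<close>.\<close>
  let ?r = "2 ^ d / real t ^ K"
  have cP: "real (card (?P J)) \<le> ?r ^ w * card ?F" if J: "J \<in> ?J w" "w \<le> t" for J w
  proof -
    obtain W T where [simp]: "J = (W, T)" by (cases J)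
    have W: "W \<subseteq> ?V" "card W = w" and T: "T \<subseteq> A" "card T = w" using J by auto
    have fW: "finite W" using W(1) by (rule finite_subset) simp
    have "card (?B W) * t ^ K \<le> 2 ^ d * (t^2) ^ d"
      by (rule card_functions_hitting) (use fW W J t in auto)
    then have "real (card (?B W)) * real t ^ K \<le> 2 ^ d * card ?G"
      unfolding cG of_nat_le_iff[where 'a=real, symmetric] by simp
    then have B: "real (card (?B W)) \<le> ?r * card ?G" using t by (simp add: field_simps)
    have "real (card (?P J)) = (\<Prod>x\<in>A. real (card (if x \<in> T then ?B W else ?G)))"
      using A by (simp add: card_PiE)
    also have "\<dots> \<le> (\<Prod>x\<in>A. (if x \<in> T then ?r else 1) * card ?G)"
      by (rule prod_mono) (use B in auto)
    also have "\<dots> = (\<Prod>x\<in>A. if x \<in> T then ?r else 1) * card ?F"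
      using A by (simp add: prod.distrib cF cG)
    also have "(\<Prod>x\<in>A. if x \<in> T then ?r else 1) = ?r ^ w"
      using A T by (simp add: prod.If_cases Int_absorb1)
    finally show ?thesis .
  qed
  have cJ: "card (?J w) \<le> (d * t^2 * card A) ^ w" for w
  proof -
    have le: "n choose w \<le> n ^ w" for n
      by (cases "w \<le> n") (auto simp: binomial_le_pow binomial_eq_0)
    show ?thesis
      using A mult_mono[OF le[of "d * t^2"] le[of "card A"]]
      by (simp add: card_cartesian_product n_subsets power_mult_distrib)
  qed
  have fJ: "finite (?J w)" for w
    using A by auto
  have finB: "finite (?B W)" for W using finG by simp
  have fP: "finite (?P J)" if "J \<in> ?J w" for J w
    using A finG finB by (cases J) (auto intro!: finite_PiE)
  \<comment> \<open>Since \<open>?J w\<close> has at most \<open>(d * t^2 * card A) ^ w\<close>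
    members, the sets of size \<open>w\<close> spoil at most a fraction \<open>y ^ w\<close> of all
    choices. The hypothesis \<open>size\<close> amounts to \<open>y \<le> 1/2\<close>.\<close>
  define y where "y = d * t^2 * card A * ?r"
  have y: "0 \<le> y" "y \<le> 1/2"
  proof -
    have "real (2 * card A * (d * t^2) * 2 ^ d) \<le> real (t ^ K)" using size by (simp only: of_nat_le_iff)
    then show "y \<le> 1/2" using t by (simp add: y_def field_simps)
  qed (simp add: y_def)
  have "real (card ?F) \<le> (\<Sum>w\<in>{1..t}. \<Sum>J\<in>?J w. real (card (?P J)))"
  proof -
    have "card ?F \<le> card (\<Union>w\<in>{1..t}. \<Union>J\<in>?J w. ?P J)"
      by (rule card_mono[OF _ sub]) (use fJ fP in blast)
    also have "\<dots> \<le> (\<Sum>w\<in>{1..t}. card (\<Union>J\<in>?J w. ?P J))" by (rule card_UN_le) simp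
    also have "\<dots> \<le> (\<Sum>w\<in>{1..t}. \<Sum>J\<in>?J w. card (?P J))"
      by (rule sum_mono, rule card_UN_le, rule fJ)
    finally show ?thesis by (simp flip: of_nat_sum)
  qed
  also have "\<dots> \<le> (\<Sum>w\<in>{1..t}. y ^ w * card ?F)"
  proof (rule sum_mono)
    fix w assume w: "w \<in> {1..t}"
    have "(\<Sum>J\<in>?J w. real (card (?P J))) \<le> real (card (?J w)) * (?r ^ w * card ?F)"
      by (rule sum_bounded_above) (use cP w in auto)
    also have "\<dots> \<le> real ((d * t^2 * card A) ^ w) * (?r ^ w * card ?F)"
      using cJ[of w] by (intro mult_right_mono) (simp_all only: of_nat_le_iff, simp)
    also have "\<dots> = y ^ w * card ?F" by (simp add: y_def power_mult_distrib power_divide)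
    finally show "(\<Sum>J\<in>?J w. real (card (?P J))) \<le> y ^ w * card ?F" .
  qed
  also have "\<dots> \<le> (\<Sum>w\<in>{1..t}. (1/2) ^ w * card ?F)"
    by (intro sum_mono mult_right_mono power_mono y) auto
  \<comment> \<open>The sizes start at \<open>w = 1\<close>, so the geometric sum stays strictly
    below 1 and the bad choices cannot exhaust \<open>?F\<close>.\<close>
  also have "\<dots> = (1 - (1/2) ^ t) * card ?F"
  proof -
    have "(\<Sum>w\<in>{1..t}. (1/2::real) ^ w) = 1 - (1/2) ^ t" by (induction t) auto
    then show ?thesis by (simp flip: sum_distrib_right)
  qed
  finally have "real (card ?F) * (1/2) ^ t \<le> 0" by (simp add: algebra_simps)
  moreover have "card ?F > 0" using t unfolding cF by simp
  ultimately show False by (metis mult_pos_pos not_le of_nat_0_less_iff zero_less_divide_1_iff zero_less_numeral zero_less_power)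
qed

text \<open>The grid version is carried over along a bijection of the grid with \<open>B\<close>:
  each \<open>x\<close> takes one vertex from each of \<open>d\<close> blocks of size
  \<open>t^2\<close>.\<close>

lemma exists_sparse_neighbourhoods:
  fixes A :: "'a set" and B :: "'b set"
  assumes A: "finite A" and B: "finite B" "card B = d * t^2" and t: "t \<ge> 1" and d: "d \<ge> 1"
    and size: "2 * card A * card B * 2 ^ d \<le> t ^ K"
  obtains N where "\<And>x. x \<in> A \<Longrightarrow> N x \<subseteq> B" "\<And>x. x \<in> A \<Longrightarrow> card (N x) = d"
    "\<And>W. W \<subseteq> B \<Longrightarrow> W \<noteq> {} \<Longrightarrow> card W \<le> t \<Longrightarrow> card {x \<in> A. K \<le> card (N x \<inter> W)} < card W"
proof -
  let ?V = "{..<d} \<times> {..<t^2}"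
  obtain b where b: "bij_betw b ?V B"
    using finite_same_card_bij[of ?V B] B by auto
  then have inj: "inj_on b ?V" and im: "b ` ?V = B" by (auto simp: bij_betw_def)
  obtain f where f: "f \<in> A \<rightarrow>\<^sub>E ({..<d} \<rightarrow>\<^sub>E {..<t^2})"
    "\<And>W. W \<subseteq> ?V \<Longrightarrow> W \<noteq> {} \<Longrightarrow> card W \<le> t \<Longrightarrow>
      card {x \<in> A. K \<le> card {i. i < d \<and> (i, f x i) \<in> W}} < card W"
    using exists_sparse_neighbourhoods_aux[OF A t d, of K] size B by (auto simp: mult.assoc)
  have fr: "f x i < t^2" if "x \<in> A" "i < d" for x i using f(1) that by (auto simp: PiE_iff)
  define N where "N x = (\<lambda>i. b (i, f x i)) ` {..<d}" for x
  have injN: "inj_on (\<lambda>i. b (i, f x i)) {..<d}" if "x \<in> A" for x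
  proof (rule inj_onI)
    fix i j assume "i \<in> {..<d}" "j \<in> {..<d}" "b (i, f x i) = b (j, f x j)"
    then show "i = j" using inj_onD[OF inj, of "(i, f x i)" "(j, f x j)"] fr that by simp
  qed
  show ?thesis
  proof (rule that[of N])
    fix x assume "x \<in> A"
    then show "N x \<subseteq> B" "card (N x) = d"
      using im fr injN by (auto simp: N_def card_image)
  next
    fix W assume W: "W \<subseteq> B" "W \<noteq> {}" "card W \<le> t"
    define W' where "W' = {v \<in> ?V. b v \<in> W}"
    have bW: "b ` W' = W" using W im by (auto simp: W'_def)
    have cW: "card W' = card W"
      using card_image[of b W'] inj bW by (metis (lifting) W'_def inj_on_subset mem_Collect_eq subsetI)
    have "card (N x \<inter> W) = card {i. i < d \<and> (i, f x i) \<in> W'}" if x: "x \<in> A" for x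
    proof -
      have "N x \<inter> W = (\<lambda>i. b (i, f x i)) ` {i. i < d \<and> (i, f x i) \<in> W'}"
        using fr x by (auto simp: N_def W'_def)
      also have "card \<dots> = card {i. i < d \<and> (i, f x i) \<in> W'}"
        by (rule card_image, rule inj_on_subset[OF injN[OF x]]) auto
      finally show ?thesis .
    qed
    then have "{x \<in> A. K \<le> card (N x \<inter> W)} = {x \<in> A. K \<le> card {i. i < d \<and> (i, f x i) \<in> W'}}" by auto
    also have "card \<dots> < card W'"
      by (rule f(2)) (use W cW bW in \<open>auto simp: W'_def\<close>)
    finally show "card {x \<in> A. K \<le> card (N x \<inter> W)} < card W" using cW by simp
  qed
qed

section \<open>Pruning vertices of small degree\<close>

text \<open>
  Vertices are deleted one at a time: those outside \<open>Top\<close> when they have fewer than \<open>c\<close> in-neighbours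
  left, and those outside \<open>Bot\<close>, which form \<open>Out\<close>, when they have fewer than \<open>c\<close> out-neighbours left.
  A deletion of the first kind charges the in-arcs present at that time, and \<open>Q\<close> collects the charged
  arcs. So only few arcs of a vertex of \<open>Out\<close> are not accounted for by \<open>Q\<close> and \<open>Out\<close>.
\<close>
lemma exists_pruned_subset:
  fixes S :: "'v set" and E :: "('v \<times> 'v) set"
  assumes fin: "finite S" and E: "E \<subseteq> S \<times> S"
    and deg: "\<And>x. x \<in> S \<Longrightarrow> x \<notin> Bot \<Longrightarrow> k \<le> card (E `` {x})"
  obtains A Out Q where "A \<subseteq> S" "Out \<subseteq> S" "A \<inter> Out = {}" "S \<inter> Top \<subseteq> A \<union> Out" "Out \<inter> Bot = {}" "Q \<subseteq> E"
    "\<forall>y\<in>A. y \<notin> Top \<longrightarrow> c \<le> card {x \<in> A. (x, y) \<in> E}"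
    "\<forall>x\<in>A. x \<notin> Bot \<longrightarrow> c \<le> card {y \<in> A. (x, y) \<in> E}"
    "\<forall>y. card {x. (x, y) \<in> Q} \<le> c"
    "\<forall>x\<in>Out. k \<le> c + card (E `` {x} \<inter> Out) + card (Q `` {x})"
proof -
  have finE: "finite E" using fin E by (simp add: finite_subset)
  have finI: "finite (R `` {x})" if "R \<subseteq> E" for R x
  using finite_subset[OF that finE] by (auto intro: finite_Image)
  \<comment> \<open>\<open>I\<close> are the vertices deleted for small in-degree, and \<open>A\<close> the survivors.\<close>
  define inv where "inv A Out I Q \<longleftrightarrow> A \<union> Out \<union> I = S \<and> A \<inter> Out = {} \<and> A \<inter> I = {} \<and> Out \<inter> I = {} \<and>
     S \<inter> Top \<subseteq> A \<union> Out \<and> Out \<inter> Bot = {} \<and> Q \<subseteq> E \<and>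
     (\<forall>x y. (x, y) \<in> Q \<longrightarrow> y \<in> I) \<and> (\<forall>x y. x \<in> A \<longrightarrow> y \<in> I \<longrightarrow> (x, y) \<in> E \<longrightarrow> (x, y) \<in> Q) \<and>
     (\<forall>y. card {x. (x, y) \<in> Q} \<le> c) \<and>
     (\<forall>x\<in>Out. k \<le> c + card (E `` {x} \<inter> Out) + card (Q `` {x}))" for A Out I Q
  have "\<exists>A. \<exists>Out I Q. inv A Out I Q"
    by (rule exI[of _ S], rule exI[of _ "{}"], rule exI[of _ "{}"], rule exI[of _ "{}"]) (auto simp: inv_def)
  \<comment> \<open>Instead of running the deletions, a state with the fewest survivors is taken: a
    survivor violating a degree bound could be deleted, giving a smaller state.\<close>
  then obtain A where A: "\<exists>Out I Q. inv A Out I Q"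
    and min: "\<And>A'. \<exists>Out I Q. inv A' Out I Q \<Longrightarrow> card A \<le> card A'"
    using ex_has_least_nat[of "\<lambda>A. \<exists>Out I Q. inv A Out I Q" _ card] by blast
  obtain Out I Q where inv: "inv A Out I Q" using A by blast
  note i = inv[unfolded inv_def]
  have finA: "finite A" using i fin by (metis finite_Un)
  have smaller: "card (A - {x}) < card A" if "x \<in> A" for x
    using finA that by (rule card_Diff1_less)
  have indeg: "c \<le> card {x \<in> A. (x, y) \<in> E}" if y: "y \<in> A" "y \<notin> Top" for y
  proof (rule ccontr)
    assume low: "\<not> ?thesis"
    \<comment> \<open>The fewer than \<open>c\<close> arcs from \<open>A\<close> to \<open>y\<close>
      are charged at this moment. No arc of \<open>Q\<close> ends in \<open>y\<close> yet, because
      arcs of \<open>Q\<close> end in \<open>I\<close>.\<close>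
    have "inv (A - {y}) Out (insert y I) (Q \<union> {x \<in> A. (x, y) \<in> E} \<times> {y})"
    proof -
      have yQ: "(x, y) \<notin> Q" for x using i y by blast
      have "card {x. (x, z) \<in> Q \<union> {x \<in> A. (x, y) \<in> E} \<times> {y}} \<le> c" for z
      proof (cases "z = y")
        case True
        then have "{x. (x, z) \<in> Q \<union> {x \<in> A. (x, y) \<in> E} \<times> {y}} = {x \<in> A. (x, y) \<in> E}" using yQ by auto
        then show ?thesis using low by simp
      next
        case False
        then show ?thesis using i by auto
      qed
      moreover have "k \<le> c + card (E `` {x} \<inter> Out) + card ((Q \<union> {x \<in> A. (x, y) \<in> E} \<times> {y}) `` {x})"
        if "x \<in> Out" for x
      proof -
        have "(Q \<union> {x \<in> A. (x, y) \<in> E} \<times> {y}) `` {x} = Q `` {x}" using i that by auto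
        then show ?thesis using i that by simp
      qed
      ultimately show ?thesis
        unfolding inv_def using i y by blast
    qed
    then show False using min[of "A - {y}"] smaller[OF y(1)] by fastforce
  qed
  have outdeg: "c \<le> card {y \<in> A. (x, y) \<in> E}" if x: "x \<in> A" "x \<notin> Bot" for x
  proof (rule ccontr)
    assume low: "\<not> ?thesis"
    have fx: "finite (E `` {x})" and fQ: "\<And>z. finite (E `` {z})" using finI by auto
    have Qx: "finite (Q `` {x})" using finI i by blast
    have "k \<le> card (E `` {x})" using deg x i by blast
    \<comment> \<open>The out-neighbours of \<open>x\<close> lie in \<open>A\<close>,
      \<open>Out\<close> or \<open>I\<close>, and the arcs from \<open>x\<close> to \<open>I\<close>
      are all in \<open>Q\<close> because \<open>x\<close> has survived so far.\<close>
    also have "\<dots> \<le> card ({y \<in> A. (x, y) \<in> E} \<union> (E `` {x} \<inter> Out) \<union> Q `` {x})"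
      by (rule card_mono) (use i x E fx finA Qx in auto)
    also have "\<dots> \<le> card {y \<in> A. (x, y) \<in> E} + card (E `` {x} \<inter> Out) + card (Q `` {x})"
      by (meson add_mono card_Un_le le_refl order_trans)
    also have "\<dots> \<le> c + card (E `` {x} \<inter> insert x Out) + card (Q `` {x})"
      using low card_mono[of "E `` {x} \<inter> insert x Out" "E `` {x} \<inter> Out"] fx by fastforce
    finally have new: "k \<le> c + card (E `` {x} \<inter> insert x Out) + card (Q `` {x})" .
    have old: "k \<le> c + card (E `` {z} \<inter> insert x Out) + card (Q `` {z})" if "z \<in> Out" for z
    proof -
      have "card (E `` {z} \<inter> Out) \<le> card (E `` {z} \<inter> insert x Out)"
        using fQ by (intro card_mono) auto
      then show ?thesis using i that by (meson add_le_mono le_refl order_trans)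
    qed
    have "inv (A - {x}) (insert x Out) I Q"
      unfolding inv_def using i x new old by blast
    then show False using min[of "A - {x}"] smaller[OF x(1)] by fastforce
  qed
  show ?thesis
    by (rule that[of A Out Q]) (use i indeg outdeg in auto)
qed

section \<open>Towers of expanding levels\<close>

text \<open>The value \<open>\<theta> i\<close> is the size up to which sets in level
  \<open>i\<close> count as small. By \<open>threshold\<close>, twice the size of a level is still
  small one level higher, so that \<open>expand\<close> applies to the vertices deleted there by
  pruning.\<close>

locale expander_tower =
  fixes L :: "nat \<Rightarrow> 'v set" and N :: "'v \<Rightarrow> 'v set" and \<theta> :: "nat \<Rightarrow> nat" and K :: nat
  assumes finite_level: "\<And>i. finite (L i)"
    and disjoint_levels: "\<And>i j. i \<noteq> j \<Longrightarrow> L i \<inter> L j = {}"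
    and nbrs: "\<And>i x. x \<in> L (Suc i) \<Longrightarrow> N x \<subseteq> L i"
    and expand: "\<And>i W. W \<subseteq> L i \<Longrightarrow> W \<noteq> {} \<Longrightarrow> card W \<le> \<theta> i \<Longrightarrow>
      card {x \<in> L (Suc i). K \<le> card (N x \<inter> W)} < card W"
    and threshold: "\<And>i. 2 * card (L i) \<le> \<theta> (Suc i)"
    and K_pos: "K \<ge> 1"
begin

text \<open>If all traces of \<open>V\<close> from level \<open>l\<close> up were small, expansion
  would make them grow strictly at each step down from \<open>M\<close>. The height
  \<open>M - l = \<theta> l\<close> gives just enough steps to exceed \<open>\<theta> l\<close> at
  level \<open>l\<close>.\<close>

lemma exists_dense_level:
  assumes deg: "\<And>i x. i < M \<Longrightarrow> x \<in> V \<inter> L (Suc i) \<Longrightarrow> K \<le> card (N x \<inter> V)"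
    and ne: "V \<inter> L M \<noteq> {}" and M: "M = l + \<theta> l"
  obtains m where "l \<le> m" "m \<le> M" "\<theta> m < card (V \<inter> L m)"
proof (rule ccontr)
  assume "\<not> thesis"
  with that have small: "card (V \<inter> L m) \<le> \<theta> m" if "l \<le> m" "m \<le> M" for m
    using that by (meson not_le)
  have fin: "finite (V \<inter> L i)" for i using finite_level by blast
  have "j < card (V \<inter> L (M - j))" if "j \<le> M - l" for j
    using that
  proof (induction j)
    case 0
    then show ?case using ne fin by (simp add: card_gt_0_iff)
  next
    case (Suc j)
    define i where "i = M - Suc j"
    have i: "M - j = Suc i" "i < M" "l \<le> i" using Suc.prems by (auto simp: i_def)
    have IH: "j < card (V \<inter> L (Suc i))" using Suc i by simp
    have eq: "N x \<inter> V = N x \<inter> (V \<inter> L i)" if "x \<in> L (Suc i)" for x using nbrs[OF that] by blast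
    have sub: "V \<inter> L (Suc i) \<subseteq> {x \<in> L (Suc i). K \<le> card (N x \<inter> (V \<inter> L i))}"
      using deg[OF i(2)] eq by auto
    have ne: "V \<inter> L i \<noteq> {}"
    proof
      assume *: "V \<inter> L i = {}"
      have "V \<inter> L (Suc i) \<noteq> {}" using IH by (metis card.empty not_less_zero)
      then obtain x where "x \<in> V \<inter> L (Suc i)" by blast
      then show False using deg[OF i(2)] eq K_pos * by fastforce
    qed
    have "card (V \<inter> L (Suc i)) \<le> card {x \<in> L (Suc i). K \<le> card (N x \<inter> (V \<inter> L i))}"
      by (rule card_mono[OF _ sub]) (use finite_level in auto)
    also have "\<dots> < card (V \<inter> L i)"
      by (rule expand) (use ne small i in auto)
    finally show ?case using IH by (simp add: i_def[symmetric])
  qed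
  from this[of "M - l"] show False using small[of l] M by simp
qed

text \<open>Pruning is applied to the levels from \<open>b\<close> to \<open>m\<close>. Among the
  vertices of level \<open>Suc i\<close> deleted for small out-degree, those with \<open>c\<close>
  charged arcs number at most \<open>card (L i)\<close>, and the others send \<open>K\<close> arcs
  to such deleted vertices one level below, so that expansion bounds them. Inductively these deleted
  sets stay below the threshold, whereas the trace at level \<open>m\<close> exceeds it, so a vertex
  there survives.\<close>

lemma exists_robust_levels:
  assumes R: "\<And>i x. i < m \<Longrightarrow> x \<in> V \<inter> L (Suc i) \<Longrightarrow> R `` {x} \<subseteq> N x \<inter> V"
    and deg: "\<And>i x. i < m \<Longrightarrow> x \<in> V \<inter> L (Suc i) \<Longrightarrow> 2 * c + K \<le> card (R `` {x})"
    and dense: "\<theta> m < card (V \<inter> L m)" and b: "b < m" and c: "c \<ge> 1"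
  obtains A where "\<And>i. A i \<subseteq> V \<inter> L i" "A m \<noteq> {}"
    "\<And>i y. b \<le> i \<Longrightarrow> i < m \<Longrightarrow> y \<in> A i \<Longrightarrow> c \<le> card {x \<in> A (Suc i). (x, y) \<in> R}"
    "\<And>i x. b \<le> i \<Longrightarrow> i < m \<Longrightarrow> x \<in> A (Suc i) \<Longrightarrow> c \<le> card {y \<in> A i. (x, y) \<in> R}"
proof -
  define S where "S = (\<Union>i\<in>{b..m}. V \<inter> L i)"
  \<comment> \<open>Arcs leaving \<open>L b\<close> are dropped, and no arc of \<open>E\<close> ends
    in \<open>L m\<close>. Hence \<open>L b\<close> is exempted from the out-degree condition as
    \<open>Bot\<close>, and \<open>L m\<close> from the in-degree condition as
    \<open>Top\<close>.\<close>
  define E where "E = {(x, y) \<in> R. \<exists>i\<in>{b..<m}. x \<in> V \<inter> L (Suc i)}"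
  have lev: "i = j" if "x \<in> L i" "x \<in> L j" for i j x using disjoint_levels that by blast
  have finS: "finite S" using finite_level by (auto simp: S_def)
  have ER: "y \<in> V \<inter> L i \<and> (x, y) \<in> R \<and> i \<in> {b..<m}" if "(x, y) \<in> E" "x \<in> L (Suc i)" for x y i
  proof -
    from that obtain j where j: "j \<in> {b..<m}" "x \<in> V \<inter> L (Suc j)" "(x, y) \<in> R" by (auto simp: E_def)
    then have "j = i" using lev that by blast
    then show ?thesis using R[of j x] nbrs[of x j] j by auto
  qed
  have ES: "E \<subseteq> S \<times> S"
  proof
    fix e assume e: "e \<in> E"
    obtain x y where [simp]: "e = (x, y)" by (cases e)
    from e obtain i where i: "i \<in> {b..<m}" "x \<in> V \<inter> L (Suc i)" by (auto simp: E_def)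
    then have "y \<in> V \<inter> L i" using ER e by auto
    then have "y \<in> S" using i unfolding S_def by (intro UN_I[of i]) auto
    moreover have "x \<in> S" using i unfolding S_def by (intro UN_I[of "Suc i"]) auto
    ultimately show "e \<in> S \<times> S" by simp
  qed
  have Eout: "E `` {x} = R `` {x}" if "x \<in> V \<inter> L (Suc i)" "i \<in> {b..<m}" for x i
    using that by (auto simp: E_def)
  have degE: "2 * c + K \<le> card (E `` {x})" if xS: "x \<in> S" "x \<notin> L b" for x
  proof -
    obtain i where i: "i \<in> {b..m}" "x \<in> V \<inter> L i" using xS unfolding S_def by blast
    with xS have "i \<noteq> b" by auto
    then obtain j where j: "i = Suc j" "j \<in> {b..<m}" using i by (cases i) auto
    then show ?thesis using deg[of j x] Eout[of x j] i by simp
  qed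
  obtain A Out Q where A: "A \<subseteq> S" "Out \<subseteq> S" "A \<inter> Out = {}" "S \<inter> L m \<subseteq> A \<union> Out" "Out \<inter> L b = {}" "Q \<subseteq> E"
    and inA: "\<forall>y\<in>A. y \<notin> L m \<longrightarrow> c \<le> card {x \<in> A. (x, y) \<in> E}"
    and outA: "\<forall>x\<in>A. x \<notin> L b \<longrightarrow> c \<le> card {y \<in> A. (x, y) \<in> E}"
    and Qin: "\<forall>y. card {x. (x, y) \<in> Q} \<le> c"
    and Qout: "\<forall>x\<in>Out. 2 * c + K \<le> c + card (E `` {x} \<inter> Out) + card (Q `` {x})"
    by (rule exists_pruned_subset[where Bot = "L b" and Top = "L m" and c = c, OF finS ES degE])
      (assumption, assumption, rule that)
  have finE: "finite E" using finS ES by (simp add: finite_subset)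
  have finQ: "finite Q" using finE A by (simp add: finite_subset)
  \<comment> \<open>Double counting of the arcs of \<open>Q\<close> between two levels: each vertex
    of \<open>L i\<close> is the head of at most \<open>c\<close> of them, and each vertex counted
    here is the tail of at least \<open>c\<close>.\<close>
  have charged: "card {x \<in> Out \<inter> L (Suc i). c \<le> card (Q `` {x})} \<le> card (L i)"
    if i: "b \<le> i" "i < m" for i
  proof -
    let ?X = "{x \<in> Out \<inter> L (Suc i). c \<le> card (Q `` {x})}"
    have finX: "finite ?X" using finite_level[of "Suc i"] by auto
    have "card ?X * c \<le> (\<Sum>x\<in>?X. card (Q `` {x}))"
      using sum_mono[of ?X "\<lambda>_. c" "\<lambda>x. card (Q `` {x})"] by simp
    also have "\<dots> = card (SIGMA x:?X. Q `` {x})"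
      using finX finQ by (subst card_SigmaI) (auto simp: finite_Image)
    also have "\<dots> \<le> card ((\<lambda>(y, x). (x, y)) ` (SIGMA y:L i. {x. (x, y) \<in> Q}))"
    proof (rule card_mono)
      show "finite ((\<lambda>(y, x). (x, y)) ` (SIGMA y:L i. {x. (x, y) \<in> Q}))"
        using finite_level by (intro finite_imageI finite_SigmaI) (auto intro: finite_subset[OF _ finite_Domain[OF finQ]])
      show "(SIGMA x:?X. Q `` {x}) \<subseteq> (\<lambda>(y, x). (x, y)) ` (SIGMA y:L i. {x. (x, y) \<in> Q})"
        using ER A(6) by (fastforce simp: image_iff)
    qed
    also have "\<dots> \<le> card (SIGMA y:L i. {x. (x, y) \<in> Q})"
      using finite_level by (intro card_image_le finite_SigmaI) (auto intro: finite_subset[OF _ finite_Domain[OF finQ]])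
    also have "\<dots> = (\<Sum>y\<in>L i. card {x. (x, y) \<in> Q})"
      using finite_level by (intro card_SigmaI) (auto intro: finite_subset[OF _ finite_Domain[OF finQ]])
    also have "\<dots> \<le> card (L i) * c"
      using sum_mono[of "L i" "\<lambda>y. card {x. (x, y) \<in> Q}" "\<lambda>_. c"] Qin by simp
    finally show ?thesis using c by simp
  qed
  have O: "card (Out \<inter> L (Suc i)) \<le> 2 * card (L i)" if "b \<le> i" "i < m" for i
    using that
  proof (induction i rule: dec_induct)
    case base
    \<comment> \<open>The out-neighbours of \<open>x\<close> in \<open>E\<close> lie in
      \<open>L b\<close>, which contains no vertex of \<open>Out\<close>. So \<open>Q\<close> alone
      must account for \<open>c + K\<close> arcs.\<close>
    have "c \<le> card (Q `` {x})" if x: "x \<in> Out \<inter> L (Suc b)" for x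
    proof -
      have "E `` {x} \<inter> Out = {}" using ER[of x _ b] x A(5) by blast
      then show ?thesis using Qout x by fastforce
    qed
    then have "{x \<in> Out \<inter> L (Suc b). c \<le> card (Q `` {x})} = Out \<inter> L (Suc b)" by blast
    then show ?case using charged[of b] base by simp
  next
    case (step i)
    let ?W = "Out \<inter> L (Suc i)"
    let ?Y = "{x \<in> L (Suc (Suc i)). K \<le> card (N x \<inter> ?W)}"
    \<comment> \<open>The induction hypothesis and \<open>threshold\<close> make the deleted part of
      the level below small enough for expansion.\<close>
    have W: "card ?W \<le> \<theta> (Suc i)" using step threshold[of i] by simp
    have "card ?Y \<le> card ?W"
    proof (cases "?W = {}")
      case True
      then show ?thesis using K_pos by (simp add: Int_commute)
    next
      case False
      then show ?thesis using expand[OF _ False W] by simp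
    qed
    also have "\<dots> \<le> card (L (Suc i))" using finite_level by (intro card_mono) auto
    finally have Y: "card ?Y \<le> card (L (Suc i))" .
    \<comment> \<open>Of the degree \<open>2 * c + K\<close>, one \<open>c\<close> pays for the arcs
      to survivors and the other for those in \<open>Q\<close>. If \<open>Q\<close> has fewer than
      \<open>c\<close> arcs at \<open>x\<close>, then \<open>K\<close> arcs to \<open>Out\<close>
      remain.\<close>
    have "Out \<inter> L (Suc (Suc i)) \<subseteq> {x \<in> Out \<inter> L (Suc (Suc i)). c \<le> card (Q `` {x})} \<union> ?Y"
    proof
      fix x assume x: "x \<in> Out \<inter> L (Suc (Suc i))"
      show "x \<in> {x \<in> Out \<inter> L (Suc (Suc i)). c \<le> card (Q `` {x})} \<union> ?Y"
      proof (cases "c \<le> card (Q `` {x})")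
        case True
        then show ?thesis using x by simp
      next
        case False
        have xV: "x \<in> V \<inter> L (Suc (Suc i))" using x A(2) by (auto simp: S_def)
        have "E `` {x} \<inter> Out \<subseteq> N x \<inter> ?W"
          using ER[of x _ "Suc i"] R[OF _ xV] step x by fastforce
        then have "card (E `` {x} \<inter> Out) \<le> card (N x \<inter> ?W)"
          using finite_level by (intro card_mono) auto
        then show ?thesis using Qout x False by fastforce
      qed
    qed
    then have "card (Out \<inter> L (Suc (Suc i))) \<le>
        card ({x \<in> Out \<inter> L (Suc (Suc i)). c \<le> card (Q `` {x})} \<union> ?Y)"
      using finite_level[of "Suc (Suc i)"] by (intro card_mono) auto
    also have "\<dots> \<le> 2 * card (L (Suc i))"
      using card_Un_le[of "{x \<in> Out \<inter> L (Suc (Suc i)). c \<le> card (Q `` {x})}" ?Y]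
        charged[of "Suc i"] step Y by simp
    finally show ?case .
  qed
  have inS: "A \<inter> L i \<subseteq> V" for i using A(1) by (auto simp: S_def)
  have finA: "finite (A \<inter> L i)" for i using finite_level by blast
  show ?thesis
  proof (rule that[of "\<lambda>i. A \<inter> L i"])
    show "A \<inter> L i \<subseteq> V \<inter> L i" for i using inS by blast
    show "A \<inter> L m \<noteq> {}"
    proof
      assume *: "A \<inter> L m = {}"
      have "V \<inter> L m \<subseteq> S" using b unfolding S_def by (intro UN_upper) simp
      \<comment> \<open>Vertices of \<open>L m\<close> are never deleted for small in-degree, so
        without survivors the whole trace lies in \<open>Out\<close>.\<close>
      then have "V \<inter> L m \<subseteq> Out \<inter> L m" using * A(4) by blast
      then have "card (V \<inter> L m) \<le> card (Out \<inter> L m)"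
        using finite_level by (intro card_mono) auto
      also have "\<dots> \<le> \<theta> m"
        using O[of "m - 1"] threshold[of "m - 1"] b by (cases m) auto
      finally show False using dense by simp
    qed
  next
    fix i y assume i: "b \<le> i" "i < m" and y: "y \<in> A \<inter> L i"
    have "y \<notin> L m" using lev i y by blast
    then have "c \<le> card {x \<in> A. (x, y) \<in> E}" using inA y by blast
    also have "\<dots> \<le> card {x \<in> A \<inter> L (Suc i). (x, y) \<in> R}"
    proof (rule card_mono)
      show "finite {x \<in> A \<inter> L (Suc i). (x, y) \<in> R}"
        by (rule finite_subset[OF _ finA[of "Suc i"]]) blast
      show "{x \<in> A. (x, y) \<in> E} \<subseteq> {x \<in> A \<inter> L (Suc i). (x, y) \<in> R}"
      proof clarify
        fix x assume x: "x \<in> A" "(x, y) \<in> E"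
        then obtain j where j: "x \<in> L (Suc j)" by (auto simp: E_def)
        then have "y \<in> L j" using ER x by blast
        then have "j = i" using lev y by blast
        then show "x \<in> A \<inter> L (Suc i) \<and> (x, y) \<in> R" using x j by (auto simp: E_def)
      qed
    qed
    finally show "c \<le> card {x \<in> A \<inter> L (Suc i). (x, y) \<in> R}" .
  next
    fix i x assume i: "b \<le> i" "i < m" and x: "x \<in> A \<inter> L (Suc i)"
    have "x \<notin> L b" using lev i x by (metis IntD2 Suc_n_not_le_n)
    then have "c \<le> card {y \<in> A. (x, y) \<in> E}" using outA x by blast
    also have "\<dots> \<le> card {y \<in> A \<inter> L i. (x, y) \<in> R}"
    proof (rule card_mono)
      show "finite {y \<in> A \<inter> L i. (x, y) \<in> R}"
        by (rule finite_subset[OF _ finA[of i]]) blast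
      show "{y \<in> A. (x, y) \<in> E} \<subseteq> {y \<in> A \<inter> L i. (x, y) \<in> R}" using ER x by blast
    qed
    finally show "c \<le> card {y \<in> A \<inter> L i. (x, y) \<in> R}" .
  qed
qed

end

section \<open>Leaves and greedy embedding of forests\<close>

text \<open>Otherwise the first vertex of a longest path has a neighbour in \<open>W\<close> besides
  its successor on the path. That neighbour either prolongs the path or closes a cycle.\<close>

lemma forest_has_leaf:
  assumes "finite W" and "W \<noteq> {}" and "\<not> (\<exists>c. undirected_cycle E c)"
    and "\<forall>e\<in>E. card e = 2"
  obtains v where "v \<in> W" "\<And>a b. a \<in> W \<Longrightarrow> b \<in> W \<Longrightarrow> {v, a} \<in> E \<Longrightarrow> {v, b} \<in> E \<Longrightarrow> a = b"
proof (rule ccontr)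
  note leaf = that
  assume "\<not> thesis"
  with leaf have two: "\<exists>a b. a \<in> W \<and> b \<in> W \<and> {v, a} \<in> E \<and> {v, b} \<in> E \<and> a \<noteq> b" if "v \<in> W" for v
    using \<open>v \<in> W\<close> by blast
  define path where "path p \<longleftrightarrow> p \<noteq> [] \<and> distinct p \<and> set p \<subseteq> W \<and>
    (\<forall>i. Suc i < length p \<longrightarrow> {p ! i, p ! Suc i} \<in> E)" for p
  have len: "length p \<le> card W" if "path p" for p
    using that assms(1) unfolding path_def by (metis card_mono distinct_card)
  obtain w where "w \<in> W" using assms(2) by blast
  then have "path [w]" by (simp add: path_def)
  then have "\<exists>p. path p \<and> (\<forall>q. path q \<longrightarrow> length q \<le> length p)"
    by (rule ex_has_greatest_nat[where b = "Suc (card W)"]) (simp add: len less_Suc_eq_le le_SucI)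
  then obtain p where p: "path p" and max: "\<And>q. path q \<Longrightarrow> length q \<le> length p" by blast
  have loop: "{x} \<notin> E" for x using assms(4) by fastforce
  obtain x q where xq: "p = x # q" using p by (cases p) (auto simp: path_def)
  obtain a b where ab: "a \<in> W" "b \<in> W" "{x, a} \<in> E" "{x, b} \<in> E" "a \<noteq> b"
    using two[of x] p xq by (auto simp: path_def)
  obtain y where y: "y \<in> W" "{x, y} \<in> E" "q = [] \<or> y \<noteq> hd q"
    using ab by metis
  have "y \<noteq> x" using y(2) loop by auto
  show False
  proof (cases "y \<in> set q")
    case False
    have "path (y # p)"
      unfolding path_def
    proof (intro conjI allI impI)
      fix i assume "Suc i < length (y # p)"
      then show "{(y # p) ! i, (y # p) ! Suc i} \<in> E"
        using p y xq by (cases i) (auto simp: path_def insert_commute)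
    qed (use p y xq False \<open>y \<noteq> x\<close> in \<open>auto simp: path_def\<close>)
    then show False using max[of "y # p"] by simp
  next
    case True
    then obtain j where j: "j < length q" "q ! j = y" by (auto simp: in_set_conv_nth)
    \<comment> \<open>As \<open>y\<close> is not the successor of \<open>x\<close>, the cycle has at
      least three vertices.\<close>
    have "j \<noteq> 0"
    proof
      assume "j = 0"
      then show False using j y(3) by (cases q) auto
    qed
    \<comment> \<open>Since \<open>y = p ! Suc j\<close>, this is the part of the path from
      \<open>x\<close> to \<open>y\<close>; the edge between these two closes it.\<close>
    let ?c = "take (Suc (Suc j)) p"
    have lc: "length ?c = Suc (Suc j)" using j xq by simp
    have "undirected_cycle E ?c"
      unfolding undirected_cycle_def
    proof (intro conjI allI impI)
      show "3 \<le> length ?c" using lc \<open>j \<noteq> 0\<close> by simp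
      show "distinct ?c" using p by (simp add: path_def)
      fix i assume i: "i < length ?c"
      show "{?c ! i, ?c ! (Suc i mod length ?c)} \<in> E"
      proof (cases "i = Suc j")
        case True
        then show ?thesis using lc y j xq by (simp add: insert_commute)
      next
        case False
        then have "Suc i < Suc (Suc j)" using i lc by simp
        moreover have "Suc j < length p" using j xq by simp
        ultimately have "?c ! i = p ! i" "?c ! (Suc i mod length ?c) = p ! Suc i" "Suc i < length p"
          using lc by simp_all
        then show ?thesis using p by (simp add: path_def)
      qed
    qed
    then show False using assms(3) by blast
  qed
qed

text \<open>
  A forest is built up by adding leaves or isolated vertices. Each step moves at most one level, so the
  embedding never leaves the levels between \<open>- c\<close> and \<open>c\<close>.
\<close>
lemma embed_forest:
  fixes A :: "int \<Rightarrow> 'v set" and P :: "('a \<times> 'a) set"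
  assumes forest: "\<not> (\<exists>c. undirected_cycle E c)" "\<forall>e\<in>E. card e = 2"
    and P: "\<And>u v. (u, v) \<in> P \<Longrightarrow> {u, v} \<in> E" "\<And>u v. (u, v) \<in> P \<Longrightarrow> (v, u) \<notin> P"
    and inn: "\<And>i y. \<bar>i\<bar> < int c \<Longrightarrow> y \<in> A i \<Longrightarrow> c \<le> card {x \<in> A (i + 1). (x, y) \<in> R}"
    and out: "\<And>i x. \<bar>i\<bar> < int c \<Longrightarrow> x \<in> A i \<Longrightarrow> c \<le> card {y \<in> A (i - 1). (x, y) \<in> R}"
    and zero: "c \<le> card (A 0)"
    and W: "finite W" "card W \<le> c"
  shows "\<exists>\<phi>. inj_on \<phi> W \<and> (\<forall>v\<in>W. \<exists>i. \<bar>i\<bar> \<le> int (card W) \<and> \<phi> v \<in> A i) \<and>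
    (\<forall>u\<in>W. \<forall>v\<in>W. (u, v) \<in> P \<longrightarrow> (\<phi> u, \<phi> v) \<in> R)"
  using W
proof (induction "card W" arbitrary: W)
  case 0
  then show ?case by simp
next
  case (Suc n)
  have "W \<noteq> {}" using Suc.hyps(2) by auto
  obtain v where v: "v \<in> W" and leaf: "\<And>a b. a \<in> W \<Longrightarrow> b \<in> W \<Longrightarrow> {v, a} \<in> E \<Longrightarrow> {v, b} \<in> E \<Longrightarrow> a = b"
    using forest_has_leaf[OF Suc.prems(1) \<open>W \<noteq> {}\<close> forest] by metis
  define U where "U = W - {v}"
  have U: "finite U" "card U = n" "W = insert v U" "v \<notin> U" "Suc n \<le> c" "card W = Suc n"
    using Suc v by (auto simp: U_def)
  then obtain \<phi> where \<phi>: "inj_on \<phi> U" "\<And>u. u \<in> U \<Longrightarrow> \<exists>i. \<bar>i\<bar> \<le> int n \<and> \<phi> u \<in> A i"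
    "\<And>u w. u \<in> U \<Longrightarrow> w \<in> U \<Longrightarrow> (u, w) \<in> P \<Longrightarrow> (\<phi> u, \<phi> w) \<in> R"
    using Suc.hyps(1)[of U] by auto
  have noloop: "(x, x) \<notin> P" for x using P(2) by blast
  \<comment> \<open>Fewer than \<open>c\<close> vertices are occupied by \<open>U\<close>, so a set
    \<open>B\<close> of at least \<open>c\<close> admissible places for \<open>v\<close> contains a
    free one.\<close>
  have extend: ?case
    if B: "c \<le> card B" "B \<subseteq> A i" "\<bar>i\<bar> \<le> int (Suc n)"
      and nb: "\<And>y u. y \<in> B \<Longrightarrow> u \<in> U \<Longrightarrow> (u, v) \<in> P \<Longrightarrow> (\<phi> u, y) \<in> R"
        "\<And>y u. y \<in> B \<Longrightarrow> u \<in> U \<Longrightarrow> (v, u) \<in> P \<Longrightarrow> (y, \<phi> u) \<in> R" for B i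
  proof -
    have "card (\<phi> ` U) < card B"
      using card_image_le[OF U(1), of \<phi>] U B by linarith
    then obtain y where y: "y \<in> B" "y \<notin> \<phi> ` U"
      by (metis U(1) card_mono finite_imageI not_less subsetI)
    show ?thesis
    proof (intro exI[of _ "\<phi>(v := y)"] conjI ballI impI)
      show "inj_on (\<phi>(v := y)) W"
        using \<phi>(1) y U by (auto simp: inj_on_def)
      show "\<exists>i. \<bar>i\<bar> \<le> int (card W) \<and> (\<phi>(v := y)) u \<in> A i" if "u \<in> W" for u
      proof (cases "u = v")
        case True
        then show ?thesis using y B U(6) by auto
      next
        case False
        then have "u \<in> U" using that U by auto
        with \<phi>(2) obtain j where "\<bar>j\<bar> \<le> int n" "\<phi> u \<in> A j" by blast
        then show ?thesis using False U(6) by (intro exI[of _ j]) simp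
      qed
      show "((\<phi>(v := y)) u, (\<phi>(v := y)) w) \<in> R" if "u \<in> W" "w \<in> W" "(u, w) \<in> P" for u w
        using that \<phi>(3)[of u w] nb[OF y(1)] noloop U by (cases "u = v"; cases "w = v") auto
    qed
  qed
  show ?case
  proof (cases "\<exists>w\<in>U. (w, v) \<in> P \<or> (v, w) \<in> P")
    case False
    then show ?thesis using extend[of "A 0" 0] zero by auto
  next
    case True
    then obtain w where w: "w \<in> U" "(w, v) \<in> P \<or> (v, w) \<in> P" by blast
    \<comment> \<open>By the leaf property \<open>w\<close> is the only neighbour of
      \<open>v\<close> in \<open>U\<close>, so a single arc has to be respected.\<close>
    have uniq: "u = w" if "u \<in> U" "(u, v) \<in> P \<or> (v, u) \<in> P" for u
    proof (rule leaf)
      have "{v, x} \<in> E" if "(x, v) \<in> P \<or> (v, x) \<in> P" for x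
        using that P(1) by (metis insert_commute)
      then show "{v, u} \<in> E" "{v, w} \<in> E" using that w by blast+
    qed (use that w U(3) in auto)
    obtain i where i: "\<bar>i\<bar> \<le> int n" "\<phi> w \<in> A i" using \<phi>(2)[OF w(1)] by blast
    have ic: "\<bar>i\<bar> < int c" using i U(5) by linarith
    show ?thesis
    proof (cases "(w, v) \<in> P")
      case True
      then have "(v, w) \<notin> P" using P(2) by blast
      \<comment> \<open>As the head of the arc, \<open>v\<close> is placed one level below
        \<open>w\<close>, where \<open>out\<close> provides room. In the other case it goes one
        level above, by \<open>inn\<close>.\<close>
      let ?B = "{y \<in> A (i - 1). (\<phi> w, y) \<in> R}"
      show ?thesis
      proof (rule extend[of ?B "i - 1"])
        show "c \<le> card ?B" by (rule out[OF ic i(2)])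
        show "\<bar>i - 1\<bar> \<le> int (Suc n)" using i(1) by linarith
        show "(\<phi> u, y) \<in> R" if "y \<in> ?B" "u \<in> U" "(u, v) \<in> P" for y u
          using uniq[OF that(2)] that(1,3) by simp
        show "(y, \<phi> u) \<in> R" if "y \<in> ?B" "u \<in> U" "(v, u) \<in> P" for y u
          using uniq[OF that(2)] that(3) \<open>(v, w) \<notin> P\<close> by simp
      qed auto
    next
      case False
      let ?B = "{x \<in> A (i + 1). (x, \<phi> w) \<in> R}"
      show ?thesis
      proof (rule extend[of ?B "i + 1"])
        show "c \<le> card ?B" by (rule inn[OF ic i(2)])
        show "\<bar>i + 1\<bar> \<le> int (Suc n)" using i(1) by linarith
        show "(\<phi> u, y) \<in> R" if "y \<in> ?B" "u \<in> U" "(u, v) \<in> P" for y u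
          using uniq[OF that(2)] that(3) False by simp
        show "(y, \<phi> u) \<in> R" if "y \<in> ?B" "u \<in> U" "(v, u) \<in> P" for y u
          using uniq[OF that(2)] that(1,3) by simp
      qed auto
    qed
  qed
qed

section \<open>From embeddings to subdigraphs\<close>

lemma not_free_ofI:
  fixes F :: "'a pair_pre_digraph" and H :: "'b pair_pre_digraph"
  assumes F: "nonnull_digraph F" and H: "pair_digraph H"
    and \<phi>: "inj_on \<phi> (pverts F)" "\<phi> ` pverts F \<subseteq> pverts H"
      "\<And>u v. (u, v) \<in> parcs F \<Longrightarrow> (\<phi> u, \<phi> v) \<in> parcs H"
  shows "\<not> free_of F H"
proof -
  interpret F: pair_digraph F using F by (simp add: nonnull_digraph_def)
  interpret H: pair_digraph H by (rule H)
  \<comment> \<open>Only images of arcs of \<open>F\<close> are taken, since \<open>H\<close> may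
    have further arcs between these vertices.\<close>
  define S where "S = \<lparr>pverts = \<phi> ` pverts F, parcs = map_prod \<phi> \<phi> ` parcs F\<rparr>"
  have S: "pair_digraph S"
  proof
    fix e assume "e \<in> parcs S"
    then obtain u v where e: "(u, v) \<in> parcs F" "e = (\<phi> u, \<phi> v)" by (auto simp: S_def)
    then have uv: "u \<in> pverts F" "v \<in> pverts F" "u \<noteq> v"
      using F.in_arcsD1 F.in_arcsD2 F.pair_no_loops by fastforce+
    then show "fst e \<in> pverts S" "snd e \<in> pverts S" "fst e \<noteq> snd e"
      using e \<phi>(1) by (auto simp: S_def dest: inj_onD)
  qed (auto simp: S_def F.pair_finite_verts F.pair_finite_arcs)
  have "subdigraph S H"
    unfolding subdigraph_def nonnull_digraph_def subgraph_def compatible_def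
    using S F H \<phi> by (auto simp: S_def nonnull_digraph_def wf_digraph_wp_iff pair_digraph.pair_wf_digraph)
  moreover have "digraph_iso (with_proj F) (with_proj S)"
  proof -
    let ?f = "\<lparr>iso_verts = \<phi>, iso_arcs = map_prod \<phi> \<phi>, iso_head = snd, iso_tail = fst\<rparr>"
    have "inj_on (map_prod \<phi> \<phi>) (parcs F)"
      using \<phi>(1) F.in_arcsD1 F.in_arcsD2 by (auto simp: inj_on_def)
    then have "pre_digraph.digraph_isomorphism (with_proj F) ?f"
      using \<phi>(1) F.wf_digraph_axioms by (auto simp: pre_digraph.digraph_isomorphism_def)
    moreover have "with_proj S = app_iso ?f (with_proj F)"
      by (simp add: app_iso_def with_proj_def S_def)
    ultimately show ?thesis unfolding digraph_iso_def by blast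
  qed
  ultimately show ?thesis by (auto simp: free_of_def)
qed

section \<open>Construction of the tower\<close>

text \<open>
  Level \<open>i\<close> of the tower has \<open>d * (tower_threshold d i)\<^sup>2\<close> vertices. With two consecutive such sizes
  the union bound needs \<open>8 * d^4 * 2^d * t^6 \<le> t^7\<close> for \<open>t = tower_threshold d i\<close>.
\<close>
primrec tower_threshold :: "nat \<Rightarrow> nat \<Rightarrow> nat" where
  "tower_threshold d 0 = 8 * d^4 * 2^d"
| "tower_threshold d (Suc i) = 2 * d * (tower_threshold d i)^2"

lemma tower_threshold_ge:
  assumes "d \<ge> 1"
  shows "8 * d^4 * 2^d \<le> tower_threshold d i"
proof (induction i)
  case (Suc i)
  have "0 < 8 * d^4 * 2^d" using assms by simp
  with Suc have "0 < tower_threshold d i" by linarith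
  then have "tower_threshold d i * 1 \<le> tower_threshold d i * (2 * d * tower_threshold d i)"
    using assms by (intro mult_le_mono2) (simp add: Suc_le_eq)
  then have "tower_threshold d i \<le> tower_threshold d (Suc i)" by (simp add: power2_eq_square mult_ac)
  with Suc show ?case by (rule order_trans)
qed simp

text \<open>Expansion concerns only the arcs between two consecutive levels, so the neighbourhoods
  can be chosen for each such pair separately. Encoding the index into the vertices makes the levels
  disjoint, and \<open>threshold\<close> holds with equality by the recursion of
  \<open>tower_threshold\<close>.\<close>

lemma exists_expander_tower:
  assumes d: "d \<ge> 1"
  obtains L :: "nat \<Rightarrow> nat set" and N where "expander_tower L N (tower_threshold d) 7"
    "\<And>i x. x \<in> L (Suc i) \<Longrightarrow> card (N x) = d" "\<And>i. d \<le> card (L i)"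
proof -
  let ?t = "tower_threshold d"
  define L where "L i = (\<lambda>x. prod_encode (i, x)) ` {..<d * (?t i)^2}" for i
  have t: "?t i \<ge> 1" for i using tower_threshold_ge[OF d, of i] d by (simp add: Suc_le_eq order_less_le_trans[rotated])
  have cL: "card (L i) = d * (?t i)^2" and fL: "finite (L i)" for i
    by (auto simp: L_def card_image inj_on_def)
  have size: "2 * card (L (Suc i)) * card (L i) * 2 ^ d \<le> ?t i ^ 7" for i
  proof -
    have "2 * card (L (Suc i)) * card (L i) * 2 ^ d = (8 * d^4 * 2^d) * ?t i ^ 6"
      unfolding cL by (simp add: power_mult_distrib power_numeral_reduce mult_ac)
    also have "\<dots> \<le> ?t i * ?t i ^ 6" by (intro mult_le_mono1 tower_threshold_ge d)
    finally show ?thesis by (simp add: power_numeral_reduce mult_ac)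
  qed
  define good where "good i N \<longleftrightarrow> (\<forall>x\<in>L (Suc i). N x \<subseteq> L i \<and> card (N x) = d) \<and>
      (\<forall>W. W \<subseteq> L i \<longrightarrow> W \<noteq> {} \<longrightarrow> card W \<le> ?t i \<longrightarrow>
        card {x \<in> L (Suc i). 7 \<le> card (N x \<inter> W)} < card W)" for i N
  have "\<exists>N. good i N" for i
  proof -
    obtain N where "\<And>x. x \<in> L (Suc i) \<Longrightarrow> N x \<subseteq> L i" "\<And>x. x \<in> L (Suc i) \<Longrightarrow> card (N x) = d"
      "\<And>W. W \<subseteq> L i \<Longrightarrow> W \<noteq> {} \<Longrightarrow> card W \<le> ?t i \<Longrightarrow> card {x \<in> L (Suc i). 7 \<le> card (N x \<inter> W)} < card W"
      using exists_sparse_neighbourhoods[OF fL fL cL t d size] by blast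
    then show ?thesis by (auto simp: good_def)
  qed
  then obtain f where f: "\<And>i. good i (f i)" by metis
  \<comment> \<open>The level is read off the encoded vertex. The \<open>- 1\<close> is due to
    \<open>f i\<close> describing the arcs that leave \<open>L (Suc i)\<close>.\<close>
  define N where "N x = f (fst (prod_decode x) - 1) x" for x
  have N: "N x = f i x" if "x \<in> L (Suc i)" for i x using that by (auto simp: N_def L_def)
  show ?thesis
  proof (rule that[of L N])
    show "expander_tower L N ?t 7"
    proof
      show "L i \<inter> L j = {}" if "i \<noteq> j" for i j using that by (auto simp: L_def)
      show "N x \<subseteq> L i" if "x \<in> L (Suc i)" for i x using f that N by (auto simp: good_def)
      show "card {x \<in> L (Suc i). 7 \<le> card (N x \<inter> W)} < card W"
        if "W \<subseteq> L i" "W \<noteq> {}" "card W \<le> ?t i" for i W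
      proof -
        have "{x \<in> L (Suc i). 7 \<le> card (N x \<inter> W)} = {x \<in> L (Suc i). 7 \<le> card (f i x \<inter> W)}"
          using N by auto
        then show ?thesis using f[of i] that by (simp add: good_def)
      qed
    qed (auto simp: fL cL)
    show "card (N x) = d" if "x \<in> L (Suc i)" for i x using f[of i] that N[OF that] by (simp add: good_def)
    show "d \<le> card (L i)" for i using t[of i] by (simp add: cL)
  qed
qed

section \<open>The host digraph and its subdigraphs of large out-degree\<close>

lemma out_degree_with_proj: "out_degree (with_proj D) x = card (parcs D `` {x})"
proof -
  have "out_arcs (with_proj D) x = Pair x ` (parcs D `` {x})" by (auto simp: out_arcs_def)
  then show ?thesis by (simp add: out_degree_def card_image inj_on_def)
qed

lemma le_min_out_degree_iff:
  assumes "nonnull_digraph D"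
  shows "k \<le> min_out_degree D \<longleftrightarrow> (\<forall>x\<in>pverts D. k \<le> card (parcs D `` {x}))"
proof -
  interpret pair_digraph D using assms by (simp add: nonnull_digraph_def)
  show ?thesis
    using assms pair_finite_verts
    by (simp add: min_out_degree_def nonnull_digraph_def out_degree_with_proj Min_ge_iff)
qed

text \<open>The arcs from \<open>L 0\<close> to \<open>L M\<close> close the tower up: without them
  the vertices of \<open>L 0\<close> would have no out-arcs.\<close>

definition tower_digraph :: "(nat \<Rightarrow> 'v set) \<Rightarrow> ('v \<Rightarrow> 'v set) \<Rightarrow> nat \<Rightarrow> 'v pair_pre_digraph" where
  "tower_digraph L N M = \<lparr>pverts = (\<Union>i\<le>M. L i),
     parcs = (\<Union>i<M. SIGMA x:L (Suc i). N x) \<union> L 0 \<times> L M\<rparr>"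

context expander_tower
begin

lemma lev_unique: "x \<in> L i \<Longrightarrow> x \<in> L j \<Longrightarrow> i = j"
  using disjoint_levels by blast

lemma tower_arcs_Suc:
  "x \<in> L (Suc i) \<Longrightarrow> i < M \<Longrightarrow> parcs (tower_digraph L N M) `` {x} = N x"
  using lev_unique by (fastforce simp: tower_digraph_def)

lemma tower_arcs_0:
  "x \<in> L 0 \<Longrightarrow> parcs (tower_digraph L N M) `` {x} = L M"
  using lev_unique by (fastforce simp: tower_digraph_def)

text \<open>The assumption \<open>M \<ge> 1\<close> makes \<open>L 0\<close> and \<open>L M\<close>
  disjoint, so that the closing arcs are not loops.\<close>

lemma nonnull_tower_digraph:
  assumes "M \<ge> 1" and "L 0 \<noteq> {}"
  shows "nonnull_digraph (tower_digraph L N M)"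
proof -
  have sub: "parcs (tower_digraph L N M) \<subseteq> pverts (tower_digraph L N M) \<times> pverts (tower_digraph L N M)"
    using nbrs by (fastforce simp: tower_digraph_def)
  have fin: "finite (pverts (tower_digraph L N M))"
    using finite_level by (simp add: tower_digraph_def)
  have noloop: "fst e \<noteq> snd e" if "e \<in> parcs (tower_digraph L N M)" for e
  proof -
    obtain x y where e: "e = (x, y)" by (cases e)
    from that consider i where "x \<in> L (Suc i)" "y \<in> N x" | "x \<in> L 0" "y \<in> L M"
      by (auto simp: tower_digraph_def e)
    then show ?thesis
      using nbrs lev_unique assms e by cases (fastforce, force)
  qed
  have "pair_digraph (tower_digraph L N M)"
    by unfold_locales (use sub fin noloop finite_subset[OF sub] in auto)
  then show ?thesis using assms by (auto simp: nonnull_digraph_def tower_digraph_def)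
qed

text \<open>Arcs of \<open>H\<close> lead from any vertex down to \<open>L 0\<close> and from there
  to \<open>L M\<close>, so the trace at the top is nonempty and some level \<open>m\<close> with
  \<open>m \<ge> 2 * c\<close> has a large trace. Pruning the levels from \<open>m - 2 * c\<close>
  to \<open>m\<close> leaves room to embed \<open>F\<close> around the middle level
  \<open>m - c\<close>.\<close>

lemma embed_in_tower:
  assumes F: "nonnull_digraph F" "undirected_forest (pverts F) E" "orientation_of F (pverts F) E"
    and c: "c = card (pverts F)"
    and M: "M = 2 * c + \<theta> (2 * c)"
    and H: "subdigraph H (tower_digraph L N M)" "2 * c + K \<le> min_out_degree H"
  shows "\<not> free_of F H"
proof -
  define V where "V = pverts H"
  define R where "R = parcs H"
  interpret F: pair_digraph F using F by (simp add: nonnull_digraph_def)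
  have Hn: "nonnull_digraph H" using H by (simp add: subdigraph_def)
  then interpret H: pair_digraph H by (simp add: nonnull_digraph_def)
  have c1: "c \<ge> 1" using F(1) F.pair_finite_verts c by (simp add: nonnull_digraph_def Suc_le_eq card_gt_0_iff)
  have VD: "V \<subseteq> (\<Union>i\<le>M. L i)" and RD: "R \<subseteq> parcs (tower_digraph L N M)"
    using H(1) by (auto simp: subdigraph_def subgraph_def V_def R_def tower_digraph_def)
  have deg: "2 * c + K \<le> card (R `` {x})" if "x \<in> V" for x
    using H(2) that by (simp add: le_min_out_degree_iff[OF Hn] V_def R_def)
  have RV: "R `` {x} \<subseteq> V" for x using H.in_arcsD2 by (auto simp: V_def R_def)
  have RN: "R `` {x} \<subseteq> N x \<inter> V" if "i < M" "x \<in> V \<inter> L (Suc i)" for x i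
    using RV RD tower_arcs_Suc[of x i M] that by blast
  have ex: "R `` {x} \<noteq> {}" if "x \<in> V" for x using deg[OF that] c1 by auto
  have "V \<inter> L 0 \<noteq> {}"
  proof -
    have "V \<inter> L i \<noteq> {} \<Longrightarrow> i \<le> M \<Longrightarrow> V \<inter> L 0 \<noteq> {}" for i
    proof (induction i)
      case (Suc i)
      then obtain x where x: "x \<in> V \<inter> L (Suc i)" by blast
      then have "R `` {x} \<subseteq> V \<inter> L i" using RN[of i x] nbrs[of x i] Suc.prems by auto
      then show ?case using Suc ex[of x] x by auto
    qed simp
    moreover have "V \<noteq> {}" using Hn by (simp add: nonnull_digraph_def V_def)
    ultimately show ?thesis using VD by blast
  qed
  then obtain x where "x \<in> V \<inter> L 0" by blast
  then have ne: "V \<inter> L M \<noteq> {}" using ex[of x] RV[of x] RD tower_arcs_0[of x M] by blast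
  have degN: "K \<le> card (N x \<inter> V)" if "i < M" "x \<in> V \<inter> L (Suc i)" for i x
  proof -
    have "finite (N x \<inter> V)" using H.pair_finite_verts by (simp add: V_def)
    then show ?thesis using card_mono[OF _ RN[OF that]] deg[of x] that by simp
  qed
  obtain m where m: "2 * c \<le> m" "m \<le> M" "\<theta> m < card (V \<inter> L m)"
  proof (rule exists_dense_level[of M V "2 * c"])
    show "K \<le> card (N x \<inter> V)" if "i < M" "x \<in> V \<inter> L (Suc i)" for i x
      using degN that by blast
  qed (use ne M that in auto)
  obtain A where A: "\<And>i. A i \<subseteq> V \<inter> L i" "A m \<noteq> {}"
    and Ain: "\<And>i y. m - 2 * c \<le> i \<Longrightarrow> i < m \<Longrightarrow> y \<in> A i \<Longrightarrow> c \<le> card {x \<in> A (Suc i). (x, y) \<in> R}"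
    and Aout: "\<And>i x. m - 2 * c \<le> i \<Longrightarrow> i < m \<Longrightarrow> x \<in> A (Suc i) \<Longrightarrow> c \<le> card {y \<in> A i. (x, y) \<in> R}"
  proof (rule exists_robust_levels[of m V R c "m - 2 * c"])
    show "R `` {x} \<subseteq> N x \<inter> V" "2 * c + K \<le> card (R `` {x})" if "i < m" "x \<in> V \<inter> L (Suc i)" for i x
      using RN[of i x] deg[of x] that m by auto
  qed (use m c1 that in auto)
  have finA: "finite (A i)" for i using A(1) finite_level by (meson finite_Int finite_subset)
  have down: "c \<le> card (A i)" if i: "m - 2 * c \<le> i" "i < m" "A (Suc i) \<noteq> {}" for i
  proof -
    obtain x where "x \<in> A (Suc i)" using i by blast
    then have "c \<le> card {y \<in> A i. (x, y) \<in> R}" using Aout i by blast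
    also have "\<dots> \<le> card (A i)" using finA by (intro card_mono) auto
    finally show ?thesis .
  qed
  \<comment> \<open>Nonemptiness passes down from \<open>A m\<close>. Once it reaches level
    \<open>m - (c - 1)\<close>, the fact \<open>down\<close> yields \<open>c\<close> vertices in the
    middle level.\<close>
  have "A (m - j) \<noteq> {}" if "j < c" for j
    using that
  proof (induction j)
    case (Suc j)
    then have "Suc (m - Suc j) = m - j" using m by auto
    then have "c \<le> card (A (m - Suc j))" using down[of "m - Suc j"] Suc m by auto
    then show ?case using c1 by auto
  qed (use A in simp)
  from this[of "c - 1"] have zero: "c \<le> card (A (m - c))"
    using down[of "m - c"] c1 m by (simp add: Suc_diff_le Suc_diff_Suc)
  \<comment> \<open>The shift puts the middle level at \<open>0\<close>, so that the indices from
    \<open>- c\<close> to \<open>c\<close> are exactly the pruned levels.\<close>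
  define A' where "A' i = A (nat (int (m - c) + i))" for i
  have E: "\<not> (\<exists>c. undirected_cycle E c)" "\<forall>e\<in>E. card e = 2"
    using F(2) by (auto simp: undirected_forest_def undirected_graph_def)
  have P: "{u, v} \<in> E" "(v, u) \<notin> parcs F" if "(u, v) \<in> parcs F" for u v
    using F(3) that by (auto simp: orientation_of_def)
  have "\<exists>\<phi>. inj_on \<phi> (pverts F) \<and> (\<forall>v\<in>pverts F. \<exists>i. \<bar>i\<bar> \<le> int (card (pverts F)) \<and> \<phi> v \<in> A' i) \<and>
    (\<forall>u\<in>pverts F. \<forall>v\<in>pverts F. (u, v) \<in> parcs F \<longrightarrow> (\<phi> u, \<phi> v) \<in> R)"
  proof (rule embed_forest[OF E P])
    show "c \<le> card {x \<in> A' (i + 1). (x, y) \<in> R}" if i: "\<bar>i\<bar> < int c" and y: "y \<in> A' i" for i y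
    proof -
      define n where "n = nat (int (m - c) + i)"
      have n: "m - 2 * c \<le> n" "n < m" "nat (int (m - c) + (i + 1)) = Suc n"
        unfolding n_def using i m by linarith+
      have "y \<in> A n" using y by (simp only: A'_def n_def)
      from Ain[OF n(1,2) this] show ?thesis unfolding A'_def n(3) .
    qed
    show "c \<le> card {y \<in> A' (i - 1). (x, y) \<in> R}" if i: "\<bar>i\<bar> < int c" and x: "x \<in> A' i" for i x
    proof -
      define n where "n = nat (int (m - c) + (i - 1))"
      have n: "m - 2 * c \<le> n" "n < m" "nat (int (m - c) + i) = Suc n"
        unfolding n_def using i m by linarith+
      have "x \<in> A (Suc n)" using x by (simp only: A'_def n(3))
      from Aout[OF n(1,2) this] show ?thesis unfolding A'_def n_def .
    qed
    show "c \<le> card (A' 0)" using zero by (simp add: A'_def)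
  qed (use F.pair_finite_verts c in auto)
  then obtain \<phi> where \<phi>: "inj_on \<phi> (pverts F)" "\<And>v. v \<in> pverts F \<Longrightarrow> \<exists>i. \<phi> v \<in> A' i"
    "\<And>u v. u \<in> pverts F \<Longrightarrow> v \<in> pverts F \<Longrightarrow> (u, v) \<in> parcs F \<Longrightarrow> (\<phi> u, \<phi> v) \<in> R" by blast
  show ?thesis
  proof (rule not_free_ofI[OF F(1) _ \<phi>(1)])
    have "A' i \<subseteq> V" for i using A(1) by (auto simp: A'_def)
    then show "\<phi> ` pverts F \<subseteq> pverts H" using \<phi>(2) unfolding V_def by blast
    show "(\<phi> u, \<phi> v) \<in> parcs H" if "(u, v) \<in> parcs F" for u v
      using \<phi>(3) that F.in_arcsD1 F.in_arcsD2 unfolding R_def by blast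
  qed (rule H.pair_digraph)
qed

end

section \<open>Refutation of an arbitrary candidate function\<close>

theorem theorem1p4:
  fixes F :: "'a pair_pre_digraph"
  assumes "oriented_forest F"
  shows "\<not> avoidable F"
proof
  assume "avoidable F"
  then obtain f :: "nat \<Rightarrow> nat" where f: "\<And>k (D :: nat pair_pre_digraph). nonnull_digraph D \<Longrightarrow> f k \<le> min_out_degree D \<Longrightarrow>
      \<exists>H. subdigraph H D \<and> free_of F H \<and> k \<le> min_out_degree H"
    unfolding avoidable_def by blast
  from assms obtain E where F: "nonnull_digraph F" "undirected_forest (pverts F) E" "orientation_of F (pverts F) E"
    unfolding oriented_forest_def orientation_of_def by blast
  define c where "c = card (pverts F)"
  \<comment> \<open>The argument \<open>2 * c + 7\<close> is the out-degree required for the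
    embedding when \<open>K = 7\<close>. The maximum guards against the value \<open>0\<close>, for
    which all levels would be empty.\<close>
  define d where "d = max 1 (f (2 * c + 7))"
  have d: "d \<ge> 1" "f (2 * c + 7) \<le> d" by (simp_all add: d_def)
  obtain L :: "nat \<Rightarrow> nat set" and N where T: "expander_tower L N (tower_threshold d) 7"
    and N: "\<And>i x. x \<in> L (Suc i) \<Longrightarrow> card (N x) = d" and L: "\<And>i. d \<le> card (L i)"
    using exists_expander_tower[OF d(1)] by blast
  interpret expander_tower L N "tower_threshold d" 7 by (rule T)
  define M where "M = 2 * c + tower_threshold d (2 * c)"
  have "1 \<le> 8 * d^4 * 2^d" using d(1) by (simp add: Suc_le_eq)
  then have "M \<ge> 1" using tower_threshold_ge[OF d(1), of "2 * c"] unfolding M_def by linarith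
  moreover have "L 0 \<noteq> {}" using L[of 0] d(1) by auto
  ultimately have nonnull: "nonnull_digraph (tower_digraph L N M)" by (rule nonnull_tower_digraph)
  have "d \<le> card (parcs (tower_digraph L N M) `` {x})" if x: "x \<in> pverts (tower_digraph L N M)" for x
  proof -
    obtain i where i: "i \<le> M" "x \<in> L i" using x by (auto simp: tower_digraph_def)
    show ?thesis
    proof (cases i)
      case 0
      then show ?thesis using i tower_arcs_0 L by simp
    next
      case (Suc j)
      then show ?thesis using i tower_arcs_Suc[of x j M] N by simp
    qed
  qed
  then have "d \<le> min_out_degree (tower_digraph L N M)" by (simp add: le_min_out_degree_iff[OF nonnull])
  then obtain H where "subdigraph H (tower_digraph L N M)" "free_of F H" "2 * c + 7 \<le> min_out_degree H"
    using f[OF nonnull, of "2 * c + 7"] d(2) by auto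
  then show False using embed_in_tower[OF F c_def M_def] by blast
qed

end
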